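(* Let $\mathrm{H}$ be a real Hilbert space. Let $f \in \Gamma_0(\cdot,\mathrm{H})$, let $x \in f^{-1}(\cdot,\mathbb{R})$ and let $v \in \partial f(0,x)$. If $f$ is twice epi-differentiable at $x$ for $v$, then the following assertions are equivalent: (i) $d^2_e f(x|v) \in \Gamma_0(\mathrm{H})$; (ii) $(\Delta^2_\tau f(x|v))_{\tau>0}$ admits a convergent supporting hyperplane.
   Context: Let $\mathrm{H}$ be a real Hilbert space with scalar product $\langle\cdot,\cdot\rangle$; $\mathbb{R}_+=[0,+\infty)$. Set limits (always as $\tau\to0$, $\tau>0$). For a family $(S_\tau)_{\tau>0}$ of subsets of a Hilbert space: $\mathrm{w}\text{-}\limsup S_\tau$ is the set of $x$ for which there exist positive $t_n\to0$ and $x_n\rightharpoonup x$ (weakly) with $x_n\in S_{t_n}$ for all $n$; $\liminf S_\tau$ is the set of $x$ such that for every positive sequence $t_n\to0$ there exist $x_n\to x$ strongly and $N$ with $x_n\in S_{t_n}$ for all $n\ge N$. The family is M-convergent (Mosco) if $\mathrm{w}\text{-}\limsup S_\tau\subset\liminf S_\tau$, and then its limit is $\liminf S_\tau$. A family of functions $f_\tau:\mathrm{H}\to\mathbb{R}\cup\{\pm\infty\}$ is M-convergent if the epigraphs $\{(x,\lambda)\in\mathrm{H}\times\mathbb{R}: f_\tau(x)\le\lambda\}$ are M-convergent in $\mathrm{H}\times\mathbb{R}$; its limit is the function whose epigraph is the limit. $\Gamma_0(\mathrm{H})$ is the set of proper, lower semi-continuous, convex functions $\mathrm{H}\to\mathbb{R}\cup\{+\infty\}$,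 with subdifferential $\partial f(x)=\{y:\langle y,z-x\rangle\le f(z)-f(x)\ \forall z\in\mathrm{H}\}$. $\Gamma_0(\cdot,\mathrm{H})$ is the set of $f:\mathbb{R}_+\times\mathrm{H}\to\mathbb{R}\cup\{+\infty\}$ with $f(t,\cdot)\in\Gamma_0(\mathrm{H})$ for all $t\ge0$; for such $f$, $\partial f(t,x):=\partial(f(t,\cdot))(x)$ and $f^{-1}(\cdot,\mathbb{R}):=\{x\in\mathrm{H}: f(t,x)\in\mathbb{R}\ \forall t\ge0\}$. Twice epi-differentiability: for $f\in\Gamma_0(\cdot,\mathrm{H})$, $x\in f^{-1}(\cdot,\mathbb{R})$, $v\in\partial f(0,x)$, put $\Delta^2_\tau f(x|v)(w):=\frac{f(\tau,x+\tau w)-f(\tau,x)-\tau\langle v,w\rangle}{\tau^2}$ (for each $\tau>0$ this is a function of $w$ belonging to $\Gamma_0(\mathrm{H})$). $f$ is twice epi-differentiable at $x$ for $v$ if $(\Delta^2_\tau f(x|v))_{\tau>0}$ is M-convergent; the limit function is denoted $d^2_ef(x|v):\mathrm{H}\to\mathbb{R}\cup\{\pm\infty\}$. Supporting hyperplane: $(z,\xi,\beta)\in\mathrm{H}\times\mathrm{H}\times\mathbb{R}$ is a supporting hyperplane of $f\in\Gamma_0(\mathrm{H})$ if $f(w)\ge\langle\xi,w\rangle+\beta$ for all $w\in\mathrm{H}$ and $f(z)=\langle\xi,z\rangle+\beta$. A family $(f_\tau)_{\tau>0}$ in $\Gamma_0(\mathrm{H})$ admits a convergent supporting hyperplane if there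 exist $(z_\tau,\xi_\tau,\beta_\tau)_{\tau>0}$ and $(z,\xi,\beta)$ in $\mathrm{H}\times\mathrm{H}\times\mathbb{R}$ such that $(z_\tau,\xi_\tau,\beta_\tau)$ is a supporting hyperplane of $f_\tau$ for every $\tau>0$ and $(z_\tau,\xi_\tau,\beta_\tau)\to(z,\xi,\beta)$ strongly as $\tau\to0$. *)

theory Defs
  imports "HOL-Analysis.Analysis"
begin

definition weakly_tendsto :: "(nat \<Rightarrow> 'a::real_inner) \<Rightarrow> 'a \<Rightarrow> bool" where
  "weakly_tendsto X x \<longleftrightarrow> (\<forall>y. (\<lambda>n. inner (X n) y) \<longlonglongrightarrow> inner x y)"

text \<open>Families indexed by \<open>\<tau> > 0\<close> are total functions on the reals; only their values at
  positive arguments are ever used.\<close>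

definition set_wlimsup :: "(real \<Rightarrow> 'a::real_inner set) \<Rightarrow> 'a set" where
  "set_wlimsup S = {x. \<exists>t X. (\<forall>n. t n > 0) \<and> t \<longlonglongrightarrow> 0 \<and>
     weakly_tendsto X x \<and> (\<forall>n::nat. X n \<in> S (t n))}"

definition set_liminf :: "(real \<Rightarrow> 'a::real_inner set) \<Rightarrow> 'a set" where
  "set_liminf S = {x. \<forall>t. (\<forall>n. t n > 0) \<and> t \<longlonglongrightarrow> 0 \<longrightarrow>
     (\<exists>X N. X \<longlonglongrightarrow> x \<and> (\<forall>n::nat. n \<ge> N \<longrightarrow> X n \<in> S (t n)))}"

definition set_M_convergent :: "(real \<Rightarrow> 'a::real_inner set) \<Rightarrow> bool" where
  "set_M_convergent S \<longleftrightarrow> set_wlimsup S \<subseteq> set_liminf S"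

text \<open>The library's \<open>epigraph\<close> is for real-valued functions only.\<close>

definition ereal_epigraph :: "('a \<Rightarrow> ereal) \<Rightarrow> ('a \<times> real) set" where
  "ereal_epigraph f = {(x, r). f x \<le> ereal r}"

definition M_convergent :: "(real \<Rightarrow> 'a::real_inner \<Rightarrow> ereal) \<Rightarrow> bool" where
  "M_convergent F \<longleftrightarrow> set_M_convergent (\<lambda>\<tau>. ereal_epigraph (F \<tau>))"

text \<open>An extended-real function is determined by its epigraph, and the lower limit of epigraphs is
  closed and upward closed in the second component, hence itself an epigraph; so the description
  is well defined.\<close>

definition M_limit :: "(real \<Rightarrow> 'a::real_inner \<Rightarrow> ereal) \<Rightarrow> 'a \<Rightarrow> ereal" where
  "M_limit F = (THE g. ereal_epigraph g = set_liminf (\<lambda>\<tau>. ereal_epigraph (F \<tau>)))"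

definition ereal_proper :: "('a \<Rightarrow> ereal) \<Rightarrow> bool" where
  "ereal_proper f \<longleftrightarrow> (\<forall>x. f x \<noteq> -\<infinity>) \<and> (\<exists>x. f x \<noteq> \<infinity>)"

definition ereal_lsc :: "('a::topological_space \<Rightarrow> ereal) \<Rightarrow> bool" where
  "ereal_lsc f \<longleftrightarrow> (\<forall>x. f x \<le> Liminf (at x) f)"

text \<open>Only used for functions that never take the value \<open>-\<infinity>\<close>, so that the sum on the
  right-hand side is unambiguous.\<close>

definition ereal_convex :: "('a::real_vector \<Rightarrow> ereal) \<Rightarrow> bool" where
  "ereal_convex f \<longleftrightarrow> (\<forall>x y. \<forall>s\<in>{0<..<1}.
     f ((1 - s) *\<^sub>R x + s *\<^sub>R y) \<le> ereal (1 - s) * f x + ereal s * f y)"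

definition Gamma0 :: "('a::real_inner \<Rightarrow> ereal) set" where
  "Gamma0 = {f. ereal_proper f \<and> ereal_lsc f \<and> ereal_convex f}"

definition subdifferential :: "('a::real_inner \<Rightarrow> ereal) \<Rightarrow> 'a \<Rightarrow> 'a set" where
  "subdifferential f x = {y. \<forall>z. ereal (inner y (z - x)) \<le> f z - f x}"

text \<open>Functions on \<open>[0,\<infinity>) \<times> H\<close> are curried; their values at negative times are irrelevant.\<close>

definition Gamma0_param :: "(real \<Rightarrow> 'a::real_inner \<Rightarrow> ereal) set" where
  "Gamma0_param = {f. \<forall>t\<ge>0. f t \<in> Gamma0}"

definition finite_points :: "(real \<Rightarrow> 'a \<Rightarrow> ereal) \<Rightarrow> 'a set" where
  "finite_points f = {x. \<forall>t\<ge>0. f t x \<in> range ereal}"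

definition second_diff_quot ::
    "(real \<Rightarrow> 'a::real_inner \<Rightarrow> ereal) \<Rightarrow> 'a \<Rightarrow> 'a \<Rightarrow> real \<Rightarrow> 'a \<Rightarrow> ereal" where
  "second_diff_quot f x v \<tau> w =
     (f \<tau> (x + \<tau> *\<^sub>R w) - f \<tau> x - ereal (\<tau> * inner v w)) / ereal (\<tau>\<^sup>2)"

definition twice_epi_differentiable ::
    "(real \<Rightarrow> 'a::real_inner \<Rightarrow> ereal) \<Rightarrow> 'a \<Rightarrow> 'a \<Rightarrow> bool" where
  "twice_epi_differentiable f x v \<longleftrightarrow> M_convergent (second_diff_quot f x v)"

definition second_epi_derivative ::
    "(real \<Rightarrow> 'a::real_inner \<Rightarrow> ereal) \<Rightarrow> 'a \<Rightarrow> 'a \<Rightarrow> 'a \<Rightarrow> ereal" where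
  "second_epi_derivative f x v = M_limit (second_diff_quot f x v)"

definition supporting_hyperplane ::
    "('a::real_inner \<Rightarrow> ereal) \<Rightarrow> 'a \<times> 'a \<times> real \<Rightarrow> bool" where
  "supporting_hyperplane f = (\<lambda>(z, \<xi>, \<beta>).
     (\<forall>w. ereal (inner \<xi> w + \<beta>) \<le> f w) \<and> f z = ereal (inner \<xi> z + \<beta>))"

definition admits_convergent_supporting_hyperplane ::
    "(real \<Rightarrow> 'a::real_inner \<Rightarrow> ereal) \<Rightarrow> bool" where
  "admits_convergent_supporting_hyperplane F \<longleftrightarrow>
     (\<exists>p l. (\<forall>\<tau>>0. supporting_hyperplane (F \<tau>) (p \<tau>)) \<and> (p \<longlongrightarrow> l) (at_right 0))"

end

theory Submission
  imports Defs "HOL-Complex_Analysis.Great_Picard"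
begin

text \<open>
  Since \<open>\<Delta>\<^sup>2\<^sub>\<tau> f(x|v)\<close> vanishes at the origin, so the limit \<open>g\<close> is at most \<open>0\<close> there, and epigraphical lower
  limits of convex functions are convex and lower semicontinuous, the only question is whether \<open>g\<close> takes
  the value \<open>-\<infinity>\<close>. Convergent supporting hyperplanes give an affine minorant of \<open>g\<close>, which rules this out.
  Conversely, let \<open>z\<^sub>\<tau>\<close> minimise \<open>\<Delta>\<^sup>2\<^sub>\<tau> f(x|v)(w) + \<parallel>w\<parallel>\<^sup>2/2\<close>; then \<open>- z\<^sub>\<tau>\<close> is a subgradient at \<open>z\<^sub>\<tau>\<close>.
  If \<open>g(0) > -\<infinity>\<close>, Mosco convergence at \<open>0\<close> yields a minorant \<open>- K - c \<parallel>w\<parallel>\<close> uniform in small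
  \<open>\<tau>\<close>, hence boundedness of \<open>z\<^sub>\<tau>\<close>. Comparing weak cluster points of \<open>z\<^sub>\<tau>\<close> with the minimiser \<open>z\<close>
  of \<open>g(w) + \<parallel>w\<parallel>\<^sup>2/2\<close> through a recovery sequence for \<open>z\<close> shows that \<open>z\<^sub>\<tau> \<rightarrow> z\<close> strongly and that the
  values converge as well.
\<close>

section \<open>Minimising over a closed convex set of the product with the reals\<close>

text \<open>For convex \<open>E\<close> this says that \<open>(z, a)\<close> minimises \<open>\<mu> + \<parallel>w\<parallel>\<^sup>2/2\<close> over \<open>(w, \<mu>) \<in> E\<close>.\<close>

definition variational_pair :: "('a::real_inner \<times> real) set \<Rightarrow> 'a \<Rightarrow> real \<Rightarrow> bool" where
  "variational_pair E z a \<longleftrightarrow>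
     (z, a) \<in> E \<and> (\<forall>(w, \<mu>) \<in> E. a - inner z (w - z) \<le> \<mu>)"

text \<open>If the bound failed at \<open>(w, \<mu>)\<close>, the segment from \<open>(0, 0)\<close>
  to that point would cross height \<open>- K\<close> at a point whose first component has norm
  below \<open>\<delta>\<close>, which \<open>avoid\<close> forbids. The constants depend on
  \<open>K\<close> and \<open>\<delta>\<close> alone, so the bound can be used uniformly over a
  family of sets.\<close>

lemma convex_epi_minorant:
  fixes E :: "('a::real_inner \<times> real) set"
  assumes conv: "convex E" and zero: "(0, 0) \<in> E" and K: "K > 0" and \<delta>: "\<delta> > 0"
    and avoid: "\<And>w. norm w < \<delta> \<Longrightarrow> (w, - K) \<notin> E"
    and mem: "(w, \<mu>) \<in> E"
  shows "- K - K / \<delta> * norm w \<le> \<mu>"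
proof (rule ccontr)
  assume "\<not> ?thesis"
  then have lt: "\<mu> < - K - K / \<delta> * norm w" by simp
  have nn: "K / \<delta> * norm w \<ge> 0" using K \<delta> by simp
  have neg: "- \<mu> > K" using lt nn by linarith
  define s where "s = K / (- \<mu>)"
  have s: "0 \<le> s" "s \<le> 1" using neg K by (auto simp: s_def field_simps)
  have "(1 - s) *\<^sub>R (0, 0) + s *\<^sub>R (w, \<mu>) \<in> E"
    using convexD[OF conv zero mem, of "1 - s" s] s by simp
  moreover have "s * \<mu> = - K" using neg K by (simp add: s_def field_simps)
  ultimately have "(s *\<^sub>R w, - K) \<in> E" by simp
  moreover have "norm (s *\<^sub>R w) < \<delta>"
  proof -
    have "K / \<delta> * norm w < - \<mu>" using lt K by linarith
    then have "K * norm w < \<delta> * (- \<mu>)" using \<delta> by (simp add: field_simps)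
    then have "K * norm w / (- \<mu>) < \<delta>" using neg K by (subst pos_divide_less_eq) auto
    moreover have "norm (s *\<^sub>R w) = K * norm w / (- \<mu>)"
      unfolding norm_scaleR abs_of_nonneg[OF s(1)] by (simp add: s_def)
    ultimately show ?thesis by simp
  qed
  ultimately show False using avoid by blast
qed

lemma power2_norm_add_scaleR:
  "(norm (z + s *\<^sub>R u))\<^sup>2 = (norm z)\<^sup>2 + 2 * s * inner z u + s * s * (norm u)\<^sup>2"
  using dot_norm[of z "s *\<^sub>R u"] by (simp add: power_mult_distrib power2_eq_square field_simps)

text \<open>This is the direct method: \<open>out\<close> keeps the objective bounded below, uniform
  convexity of the squared norm makes a minimising sequence Cauchy, and first-order optimality at
  its limit is the required inequality.\<close>

lemma variational_pair_exists:
  fixes E :: "('a::{real_inner,complete_space} \<times> real) set"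
  assumes clo: "closed E" and conv: "convex E" and zero: "(0, 0) \<in> E"
    and K: "K > 0" and out: "(0, - K) \<notin> E"
  obtains z a where "variational_pair E z a"
proof -
  obtain \<delta> where \<delta>: "\<delta> > 0" and ball: "\<And>y. dist y (0, - K) < \<delta> \<Longrightarrow> y \<notin> E"
    using clo out unfolding closed_def open_dist by (metis ComplD ComplI)
  have avoid: "(w, - K) \<notin> E" if "norm w < \<delta>" for w
    using ball[of "(w, - K)"] that by (simp add: dist_Pair_Pair)
  define c where "c = K / \<delta>"
  define \<phi> where "\<phi> = (\<lambda>y::'a \<times> real. snd y + (norm (fst y))\<^sup>2 / 2)"
  \<comment> \<open>The bound is the minimum over \<open>r\<close> of
    \<open>- K - c * r + r^2 / 2\<close>, attained at \<open>r = c\<close>.\<close>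
  have lower: "- K - c\<^sup>2 / 2 \<le> \<phi> y" if "y \<in> E" for y
  proof -
    have "- K - c * norm (fst y) \<le> snd y"
      using convex_epi_minorant[OF conv zero K \<delta> avoid, of "fst y" "snd y"] that
      by (simp add: c_def)
    moreover have "0 \<le> (norm (fst y) - c)\<^sup>2" by simp
    ultimately show ?thesis by (simp add: \<phi>_def power2_eq_square algebra_simps)
  qed
  define m where "m = Inf (\<phi> ` E)"
  have bdd: "bdd_below (\<phi> ` E)" using lower by (auto intro!: bdd_belowI)
  have m_le: "m \<le> \<phi> y" if "y \<in> E" for y
    unfolding m_def using that bdd by (intro cInf_lower) auto
  have "\<exists>y\<in>E. \<phi> y < m + inverse (real (Suc n))" for n
  proof -
    have "Inf (\<phi> ` E) < m + inverse (real (Suc n))" by (simp add: m_def)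
    then show ?thesis using cInf_lessD[of "\<phi> ` E"] zero by blast
  qed
  then obtain Y where Y: "\<And>n. Y n \<in> E" "\<And>n. \<phi> (Y n) < m + inverse (real (Suc n))" by metis
  \<comment> \<open>The midpoint of two members lies in \<open>E\<close>, so its value is at least
    \<open>m\<close>; the parallelogram identity turns this into a bound on the distance of the
    first components.\<close>
  have close: "(norm (fst (Y i) - fst (Y j)))\<^sup>2 \<le> 4 * (inverse (real (Suc i)) + inverse (real (Suc j)))" for i j
  proof -
    have "(1/2) *\<^sub>R Y i + (1/2) *\<^sub>R Y j \<in> E" using conv Y(1) by (intro convexD) auto
    from m_le[OF this] have
      "m \<le> (snd (Y i) + snd (Y j)) / 2 + (norm ((1/2) *\<^sub>R (fst (Y i) + fst (Y j))))\<^sup>2 / 2"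
      by (simp add: \<phi>_def scaleR_add_right field_simps)
    also have "(norm ((1/2) *\<^sub>R (fst (Y i) + fst (Y j))))\<^sup>2 =
        ((norm (fst (Y i)))\<^sup>2 + (norm (fst (Y j)))\<^sup>2) / 2 - (norm (fst (Y i) - fst (Y j)))\<^sup>2 / 4"
      by (simp add: power2_norm_eq_inner inner_simps inner_commute field_simps)
    finally have "(norm (fst (Y i) - fst (Y j)))\<^sup>2 \<le> 4 * (\<phi> (Y i) + \<phi> (Y j) - 2 * m)"
      by (simp add: \<phi>_def field_simps)
    also have "\<dots> \<le> 4 * (inverse (real (Suc i)) + inverse (real (Suc j)))"
      using add_strict_mono[OF Y(2)[of i] Y(2)[of j]] by (simp del: of_nat_Suc)
    finally show ?thesis .
  qed
  have "Cauchy (\<lambda>n. fst (Y n))"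
  proof (rule metric_CauchyI)
    fix e :: real assume e: "e > 0"
    obtain N where N: "8 / e\<^sup>2 < real (Suc N)" using reals_Archimedean2
      by (metis less_trans lessI of_nat_less_iff)
    have "dist (fst (Y i)) (fst (Y j)) < e" if "i \<ge> N" "j \<ge> N" for i j
    proof -
      note close[of i j]
      also have "4 * (inverse (real (Suc i)) + inverse (real (Suc j))) \<le>
          4 * (inverse (real (Suc N)) + inverse (real (Suc N)))"
        using that by (intro mult_left_mono add_mono) auto
      also have "\<dots> < e\<^sup>2" using N e by (simp add: field_simps)
      finally have "(norm (fst (Y i) - fst (Y j)))\<^sup>2 < e\<^sup>2" .
      then show ?thesis using e by (simp add: dist_norm power_less_imp_less_base)
    qed
    then show "\<exists>M. \<forall>i\<ge>M. \<forall>j\<ge>M. dist (fst (Y i)) (fst (Y j)) < e" by blast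
  qed
  then obtain z where z: "(\<lambda>n. fst (Y n)) \<longlonglongrightarrow> z" using Cauchy_convergent convergent_def by blast
  have "(\<lambda>n. \<phi> (Y n)) \<longlonglongrightarrow> m"
  proof (rule tendsto_sandwich[of "\<lambda>_. m"])
    show "(\<lambda>n. m + inverse (real (Suc n))) \<longlonglongrightarrow> m"
      using tendsto_add[OF tendsto_const[of m] LIMSEQ_inverse_real_of_nat] by simp
  qed (use m_le Y in \<open>auto simp: less_imp_le\<close>)
  then have "(\<lambda>n. \<phi> (Y n) - (norm (fst (Y n)))\<^sup>2 / 2) \<longlonglongrightarrow> m - (norm z)\<^sup>2 / 2"
    by (intro tendsto_intros z) auto
  then have snd: "(\<lambda>n. snd (Y n)) \<longlonglongrightarrow> m - (norm z)\<^sup>2 / 2" by (simp add: \<phi>_def)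
  define a where "a = m - (norm z)\<^sup>2 / 2"
  have "(\<lambda>n. (fst (Y n), snd (Y n))) \<longlonglongrightarrow> (z, a)"
    unfolding a_def by (intro tendsto_Pair z snd)
  then have mem: "(z, a) \<in> E" using closed_sequentially[OF clo] Y(1) by auto
  \<comment> \<open>Move from \<open>(z, a)\<close> towards \<open>(w, \<mu>)\<close> by a fraction
    \<open>s\<close>, compare the values and divide by \<open>s\<close>. What is left of the
    quadratic term is \<open>s * d\<close>, and \<open>s\<close> is chosen to make it at most
    \<open>e\<close>.\<close>
  have "a - inner z (w - z) \<le> \<mu>" if w: "(w, \<mu>) \<in> E" for w \<mu>
  proof (rule field_le_epsilon)
    fix e :: real assume e: "e > 0"
    define d where "d = (norm (w - z))\<^sup>2 / 2"
    define s where "s = min 1 (e / (d + 1))"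
    have d: "d \<ge> 0" by (simp add: d_def)
    have s: "0 < s" "s \<le> 1" using e d by (auto simp: s_def)
    have sd: "s * d \<le> e"
    proof -
      have "s * d \<le> e / (d + 1) * (d + 1)" using s d by (intro mult_mono) (auto simp: s_def)
      then show ?thesis using d by simp
    qed
    have "(1 - s) *\<^sub>R (z, a) + s *\<^sub>R (w, \<mu>) \<in> E"
      using conv mem w s by (intro convexD) auto
    then have "(z + s *\<^sub>R (w - z), a + s * (\<mu> - a)) \<in> E" by (simp add: algebra_simps)
    from m_le[OF this] have "a + (norm z)\<^sup>2 / 2 \<le> a + s * (\<mu> - a) + (norm (z + s *\<^sub>R (w - z)))\<^sup>2 / 2"
      by (simp add: \<phi>_def a_def)
    also have "(norm (z + s *\<^sub>R (w - z)))\<^sup>2 = (norm z)\<^sup>2 + 2 * s * inner z (w - z) + 2 * s * (s * d)"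
      unfolding power2_norm_add_scaleR by (simp add: d_def)
    finally have "0 \<le> s * (\<mu> - a + inner z (w - z) + s * d)" by (simp add: field_simps)
    then have "0 \<le> \<mu> - a + inner z (w - z) + s * d" using s(1) by (simp add: zero_le_mult_iff)
    then show "a - inner z (w - z) \<le> \<mu> + e" using sd by linarith
  qed
  with mem have "variational_pair E z a" by (auto simp: variational_pair_def)
  then show thesis by (rule that)
qed

section \<open>Weak sequential compactness\<close>

text \<open>A closed subspace of the product that avoids \<open>(0, 1)\<close> is the graph of a bounded linear
  functional on a closed subspace of the Hilbert space.\<close>

lemma graph_Riesz_representation:
  fixes G :: "('a::{real_inner,complete_space} \<times> real) set"
  assumes sub: "subspace G" and clo: "closed G" and out: "(0, 1) \<notin> G"
  obtains z where "(z, inner z z) \<in> G" "\<And>u l. (u, l) \<in> G \<Longrightarrow> l = inner z u"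
proof -
  have neg: "(- u, - l) \<in> G" if "(u, l) \<in> G" for u l
    using subspace_neg[OF sub that] by simp
  have "(0, 0) \<in> G" using subspace_0[OF sub] by (simp add: zero_prod_def)
  moreover have "(0, - 1) \<notin> G" using neg[of 0 "- 1"] out by auto
  ultimately obtain z a where za: "variational_pair G z a"
    using variational_pair_exists[OF clo subspace_imp_convex[OF sub], of 1] by auto
  \<comment> \<open>Adding an element of \<open>G\<close> to the minimiser stays in
    \<open>G\<close>. Applied to \<open>(u, l)\<close> and to its negative, the inequality becomes
    an equality, with representing vector \<open>- z\<close>.\<close>
  have le: "- inner z u \<le> l" if "(u, l) \<in> G" for u l
  proof -
    have "(z + u, a + l) \<in> G" using subspace_add[OF sub _ that, of "(z, a)"] za
      by (simp add: variational_pair_def)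
    then show ?thesis using za by (force simp: variational_pair_def)
  qed
  have eq: "l = inner (- z) u" if "(u, l) \<in> G" for u l
    using le[OF that] le[OF neg[OF that]] by simp
  have "(z, a) \<in> G" using za by (simp add: variational_pair_def)
  then have "(- z, - a) \<in> G" by (rule neg)
  moreover from eq[OF this] have "- a = inner (- z) (- z)" by simp
  ultimately show thesis using eq that by metis
qed

text \<open>A diagonal argument handles test vectors from the countable set \<open>range X\<close>.
  The vectors against which the subsequence converges form a closed subspace containing that range;
  Riesz representation there yields the limit, and orthogonal projection reduces every other test
  vector to this subspace.\<close>

lemma bounded_weakly_convergent_subsequence:
  fixes X :: "nat \<Rightarrow> 'a::{real_inner,complete_space}"
  assumes bdd: "\<And>n. norm (X n) \<le> B"
  obtains r z where "strict_mono r" "weakly_tendsto (X \<circ> r) z"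
proof -
  have "norm (inner (X n) y) \<le> B * B" if "y \<in> range X" for n y
  proof -
    have "\<bar>inner (X n) y\<bar> \<le> norm (X n) * norm y" by (rule Cauchy_Schwarz_ineq2)
    also have "\<dots> \<le> B * B" using that bdd order_trans[OF norm_ge_zero bdd[of n]]
      by (intro mult_mono) auto
    finally show ?thesis by simp
  qed
  then obtain r :: "nat \<Rightarrow> nat" where r: "strict_mono r"
    and conv: "\<And>y. y \<in> range X \<Longrightarrow> \<exists>l. (\<lambda>n. inner (X (r n)) y) \<longlonglongrightarrow> l"
    using function_convergent_subsequence[of "range X" "\<lambda>n y. inner (X n) y" "B * B"]
    by (metis countableI_type countable_image)
  define Y where "Y = X \<circ> r"
  have B: "norm (Y n) \<le> B" for n by (simp add: Y_def bdd)
  have B0: "B \<ge> 0" using order_trans[OF norm_ge_zero bdd[of 0]] .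
  \<comment> \<open>\<open>G\<close> is the graph of the limit functional on the subspace of vectors
    where the limit exists.\<close>
  define G where "G = {(u, l). (\<lambda>n. inner (Y n) u) \<longlonglongrightarrow> l}"
  have sub: "subspace G"
    unfolding subspace_def
    by (auto simp: G_def zero_prod_def inner_add_right intro!: tendsto_add tendsto_mult_left)
  have clo: "closed G"
    unfolding closed_sequential_limits
  proof (intro allI impI, elim conjE)
    fix x p assume x: "\<forall>n. x n \<in> G" and lim: "x \<longlonglongrightarrow> p"
    obtain u l where p: "p = (u, l)" by (cases p)
    have "(\<lambda>n. inner (Y n) u) \<longlonglongrightarrow> l"
    proof (rule LIMSEQ_I)
      fix e :: real assume e: "e > 0"
      \<comment> \<open>An e/3 argument: this \<open>d\<close> makes both \<open>B * d\<close> and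
        \<open>d\<close> at most \<open>e / 3\<close>, and the choice of \<open>N\<close> supplies
        the last third.\<close>
      define d where "d = e / (3 * (B + 1))"
      have d: "d > 0" "B * d \<le> e / 3" "d \<le> e / 3" using e B0 by (auto simp: d_def field_simps)
      obtain k where k: "dist (x k) p < d" using lim d(1) by (meson LIMSEQ_iff_nz lim_sequentially order_refl)
      have ku: "norm (u - fst (x k)) < d"
        using k dist_fst_le[of "x k" p] by (simp add: p dist_norm norm_minus_commute)
      have kl: "\<bar>snd (x k) - l\<bar> < d"
        using k dist_snd_le[of "x k" p] by (simp add: p dist_norm)
      have "(\<lambda>n. inner (Y n) (fst (x k))) \<longlonglongrightarrow> snd (x k)"
        using x[rule_format, of k] by (auto simp: G_def case_prod_beta)
      from LIMSEQ_D[OF this, of "e / 3"] obtain N where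
        N: "\<And>n. n \<ge> N \<Longrightarrow> \<bar>inner (Y n) (fst (x k)) - snd (x k)\<bar> < e / 3" using e by auto
      have "norm (inner (Y n) u - l) < e" if "n \<ge> N" for n
      proof -
        have "\<bar>inner (Y n) (u - fst (x k))\<bar> \<le> norm (Y n) * norm (u - fst (x k))"
          by (rule Cauchy_Schwarz_ineq2)
        also have "\<dots> \<le> B * d" using B ku B0 by (intro mult_mono) auto
        finally have "\<bar>inner (Y n) u - inner (Y n) (fst (x k))\<bar> \<le> e / 3"
          using d(2) by (simp add: inner_diff_right)
        then show ?thesis using N[OF that] kl d(3) unfolding real_norm_def by linarith
      qed
      then show "\<exists>N. \<forall>n\<ge>N. norm (inner (Y n) u - l) < e" by blast
    qed
    then show "p \<in> G" by (simp add: G_def p)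
  qed
  have "(0, 1) \<notin> G" by (auto simp: G_def LIMSEQ_const_iff)
  then obtain z where zG: "(z, inner z z) \<in> G" and z: "\<And>u l. (u, l) \<in> G \<Longrightarrow> l = inner z u"
    using graph_Riesz_representation[OF sub clo] by blast
  define D where "D = {u. (u, inner z u) \<in> G}"
  have subD: "subspace D"
    using sub unfolding subspace_def D_def
    by (auto simp: zero_prod_def inner_add_right) (metis add_Pair, metis scaleR_Pair real_scaleR_def)
  have cloD: "closed D"
  proof -
    have "D = (\<lambda>u. (u, inner z u)) -` G" by (auto simp: D_def)
    then show ?thesis by (simp add: continuous_closed_vimage[OF clo] continuous_intros)
  qed
  have YD: "Y n \<in> D" for n
  proof -
    obtain l where "(\<lambda>k. inner (Y k) (Y n)) \<longlonglongrightarrow> l" using conv[of "Y n"] by (auto simp: Y_def o_def)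
    then have "(Y n, l) \<in> G" by (simp add: G_def)
    with z show ?thesis by (auto simp: D_def)
  qed
  \<comment> \<open>The representing vector itself lies in the domain, so \<open>inner z y\<close>
    may be replaced by \<open>inner z d\<close> at the end, just as for the terms
    \<open>Y n\<close>.\<close>
  have zD: "z \<in> D" using zG by (simp add: D_def)
  have "(\<lambda>n. inner (Y n) y) \<longlonglongrightarrow> inner z y" for y
  proof -
    define P where "P = {(u, l). u \<in> D \<and> l = inner y u}"
    have subP: "subspace P"
      using subD unfolding subspace_def P_def by (auto simp: zero_prod_def inner_add_right)
    have "closed {p::'a \<times> real. snd p = inner y (fst p)}"
      by (intro closed_Collect_eq continuous_intros)
    moreover have "P = (D \<times> UNIV) \<inter> {p. snd p = inner y (fst p)}" by (auto simp: P_def)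
    ultimately have cloP: "closed P" by (simp add: closed_Int closed_Times cloD)
    have "(0, 1) \<notin> P" by (simp add: P_def)
    \<comment> \<open>\<open>d\<close> is the orthogonal projection of \<open>y\<close> to \<open>D\<close>\<close>
    then obtain d where d: "(d, inner d d) \<in> P" "\<And>u l. (u, l) \<in> P \<Longrightarrow> l = inner d u"
      using graph_Riesz_representation[OF subP cloP] by blast
    have eq: "inner u y = inner u d" if "u \<in> D" for u
      using d(2)[of u "inner y u"] that by (simp add: P_def inner_commute)
    have "d \<in> D" using d(1) by (simp add: P_def)
    then have "(\<lambda>n. inner (Y n) d) \<longlonglongrightarrow> inner z d" by (simp add: D_def G_def)
    then show ?thesis by (simp add: eq YD zD)
  qed
  then have "weakly_tendsto (X \<circ> r) z" by (simp add: weakly_tendsto_def Y_def)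
  with r show thesis by (rule that)
qed

section \<open>Lower limits of sets and epigraphs\<close>

text \<open>If \<open>P\<close> failed at arbitrarily small positive points, these would form a null
  sequence without a single good index. Since one index per sequence is enough, applications may
  pass to subsequences freely.\<close>

lemma eventually_at_right_0_sequentially:
  fixes P :: "real \<Rightarrow> bool"
  assumes "\<And>t. (\<And>n. t n > 0) \<Longrightarrow> t \<longlonglongrightarrow> 0 \<Longrightarrow> \<exists>n. P (t n)"
  shows "eventually P (at_right 0)"
proof (rule ccontr)
  assume "\<not> ?thesis"
  then have "\<exists>\<tau>>0. \<tau> < inverse (real (Suc n)) \<and> \<not> P \<tau>" for n
    unfolding eventually_at_right_field by (metis inverse_positive_iff_positive of_nat_0_less_iff zero_less_Suc)
  then obtain t where t: "\<And>n. t n > 0" "\<And>n. t n < inverse (real (Suc n))" "\<And>n. \<not> P (t n)"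
    by metis
  have "t \<longlonglongrightarrow> 0"
    by (rule tendsto_sandwich[OF _ _ tendsto_const LIMSEQ_inverse_real_of_nat])
      (use t in \<open>auto simp: less_imp_le simp del: of_nat_Suc\<close>)
  with assms t show False by blast
qed

lemma filterlim_at_right_0_sequence:
  fixes t :: "nat \<Rightarrow> real"
  assumes "\<And>n. t n > 0" "t \<longlonglongrightarrow> 0"
  shows "filterlim t (at_right 0) sequentially"
proof -
  have "t n \<in> {0<..} \<and> t n \<noteq> 0" for n using assms(1)[of n] by simp
  with assms(2) show ?thesis by (simp add: filterlim_at)
qed

text \<open>This sequence-free form makes closedness of the lower limit a triangle-inequality
  argument. From right to left, the approximating sequence consists of almost nearest
  points.\<close>

lemma set_liminf_iff_dist:
  "x \<in> set_liminf S \<longleftrightarrow> (\<forall>e>0. \<forall>\<^sub>F \<tau> in at_right 0. \<exists>y\<in>S \<tau>. dist y x < e)"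
proof (intro iffI allI impI)
  fix e :: real assume x: "x \<in> set_liminf S" and e: "e > 0"
  show "\<forall>\<^sub>F \<tau> in at_right 0. \<exists>y\<in>S \<tau>. dist y x < e"
  proof (rule eventually_at_right_0_sequentially)
    fix t :: "nat \<Rightarrow> real" assume "\<And>n. t n > 0" "t \<longlonglongrightarrow> 0"
    then obtain X N where X: "X \<longlonglongrightarrow> x" "\<And>n. n \<ge> N \<Longrightarrow> X n \<in> S (t n)"
      using x unfolding set_liminf_def by blast
    obtain M where "\<And>n. n \<ge> M \<Longrightarrow> dist (X n) x < e" using X(1) e by (meson lim_sequentially)
    then show "\<exists>n. \<exists>y\<in>S (t n). dist y x < e" using X(2) by (meson nat_le_linear)
  qed
next
  assume *: "\<forall>e>0. \<forall>\<^sub>F \<tau> in at_right 0. \<exists>y\<in>S \<tau>. dist y x < e"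
  show "x \<in> set_liminf S" unfolding set_liminf_def
  proof (intro CollectI allI impI, elim conjE)
    fix t :: "nat \<Rightarrow> real" assume t: "\<forall>n. t n > 0" "t \<longlonglongrightarrow> 0"
    then have lim: "filterlim t (at_right 0) sequentially"
      by (intro filterlim_at_right_0_sequence) auto
    have ev: "\<forall>\<^sub>F n in sequentially. \<exists>y\<in>S (t n). dist y x < e" if "e > 0" for e
      using * that lim by (auto dest: eventually_compose_filterlim)
    have ne: "\<forall>\<^sub>F n in sequentially. S (t n) \<noteq> {}"
      using ev[OF zero_less_one] by eventually_elim auto
    \<comment> \<open>The slack is there because the distance may not be attained. As
      \<open>infdist\<close> to the empty set is 0 by convention, the choice is restricted to
      nonempty \<open>S (t n)\<close>.\<close>
    have "\<exists>y\<in>S (t n). dist y x < infdist x (S (t n)) + inverse (real (Suc n))" if "S (t n) \<noteq> {}" for n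
      using that cInf_lessD[of "dist x ` S (t n)" "infdist x (S (t n)) + inverse (real (Suc n))"]
      by (auto simp: infdist_notempty dist_commute)
    then obtain X where X: "\<And>n. S (t n) \<noteq> {} \<Longrightarrow> X n \<in> S (t n)"
      "\<And>n. S (t n) \<noteq> {} \<Longrightarrow> dist (X n) x < infdist x (S (t n)) + inverse (real (Suc n))"
      by metis
    have inf0: "(\<lambda>n. infdist x (S (t n))) \<longlonglongrightarrow> 0"
    proof (rule tendstoI)
      fix e :: real assume "e > 0"
      from ev[OF this] show "\<forall>\<^sub>F n in sequentially. dist (infdist x (S (t n))) 0 < e"
      proof eventually_elim
        case (elim n)
        then obtain y where "y \<in> S (t n)" "dist y x < e" by blast
        then show ?case using infdist_le[of y "S (t n)" x] by (simp add: infdist_nonneg dist_commute)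
      qed
    qed
    have "(\<lambda>n. dist (X n) x) \<longlonglongrightarrow> 0"
    proof (rule tendsto_sandwich[of "\<lambda>_. 0"])
      show "(\<lambda>n. infdist x (S (t n)) + inverse (real (Suc n))) \<longlonglongrightarrow> 0"
        using tendsto_add[OF inf0 LIMSEQ_inverse_real_of_nat] by simp
      show "\<forall>\<^sub>F n in sequentially. dist (X n) x \<le> infdist x (S (t n)) + inverse (real (Suc n))"
        using ne by eventually_elim (use X(2) less_imp_le in blast)
    qed auto
    then have "X \<longlonglongrightarrow> x" by (rule Lim_null_comparison[THEN LIM_zero_cancel, rotated]) (simp add: dist_norm)
    moreover obtain N where "\<And>n. n \<ge> N \<Longrightarrow> S (t n) \<noteq> {}" using ne by (auto simp: eventually_sequentially)
    ultimately show "\<exists>X N. X \<longlonglongrightarrow> x \<and> (\<forall>n\<ge>N. X n \<in> S (t n))" using X(1) by blast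
  qed
qed

lemma closed_set_liminf: "closed (set_liminf S)"
proof -
  have "x \<in> set_liminf S" if x: "x \<in> closure (set_liminf S)" for x
    unfolding set_liminf_iff_dist
  proof (intro allI impI)
    fix e :: real assume e: "e > 0"
    obtain y where y: "y \<in> set_liminf S" "dist y x < e / 2"
      using x half_gt_zero[OF e] unfolding closure_approachable by blast
    have "\<forall>\<^sub>F \<tau> in at_right 0. \<exists>u\<in>S \<tau>. dist u y < e / 2"
      using y(1) half_gt_zero[OF e] unfolding set_liminf_iff_dist by blast
    then show "\<forall>\<^sub>F \<tau> in at_right 0. \<exists>u\<in>S \<tau>. dist u x < e"
    proof eventually_elim
      case (elim \<tau>)
      then obtain u where "u \<in> S \<tau>" "dist u y < e / 2" by blast
      then show ?case using dist_triangle_half_l[of u y e x] y(2) by (auto simp: dist_commute)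
    qed
  qed
  then show ?thesis by (meson closure_subset_eq subsetI)
qed

lemma convex_set_liminf:
  assumes "\<And>\<tau>. \<tau> > 0 \<Longrightarrow> convex (S \<tau>)"
  shows "convex (set_liminf S)"
proof (rule convexI)
  fix x y and a b :: real
  assume x: "x \<in> set_liminf S" and y: "y \<in> set_liminf S" and ab: "0 \<le> a" "0 \<le> b" "a + b = 1"
  show "a *\<^sub>R x + b *\<^sub>R y \<in> set_liminf S" unfolding set_liminf_def
  proof (intro CollectI allI impI)
    fix t :: "nat \<Rightarrow> real" assume t: "(\<forall>n. t n > 0) \<and> t \<longlonglongrightarrow> 0"
    obtain X N where X: "X \<longlonglongrightarrow> x" "\<And>n. n \<ge> N \<Longrightarrow> X n \<in> S (t n)"
      using x t unfolding set_liminf_def by blast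
    obtain Y M where Y: "Y \<longlonglongrightarrow> y" "\<And>n. n \<ge> M \<Longrightarrow> Y n \<in> S (t n)"
      using y t unfolding set_liminf_def by blast
    have "(\<lambda>n. a *\<^sub>R X n + b *\<^sub>R Y n) \<longlonglongrightarrow> a *\<^sub>R x + b *\<^sub>R y" by (intro tendsto_intros X Y)
    moreover have "a *\<^sub>R X n + b *\<^sub>R Y n \<in> S (t n)" if "n \<ge> max N M" for n
      using X(2) Y(2) that t assms ab by (intro convexD) auto
    ultimately show "\<exists>Z K. Z \<longlonglongrightarrow> a *\<^sub>R x + b *\<^sub>R y \<and> (\<forall>n\<ge>K. Z n \<in> S (t n))"
      by blast
  qed
qed

section \<open>Epigraphs of extended-real functions\<close>

lemma ereal_epigraph_inject:
  assumes "ereal_epigraph g = ereal_epigraph h"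
  shows "g = h"
proof
  fix x
  have "g x \<le> ereal r \<longleftrightarrow> h x \<le> ereal r" for r
    using assms by (auto simp: ereal_epigraph_def set_eq_iff)
  then show "g x = h x" by (meson antisym ereal_le_real)
qed

text \<open>Take the infimum of each vertical slice: upward closure fills the slice above it, and
  closedness adds the infimum when it is finite. Empty slices give \<infinity> and full lines give
  -\<infinity>.\<close>

lemma closed_upward_imp_ereal_epigraph:
  fixes E :: "('a::topological_space \<times> real) set"
  assumes clo: "closed E" and up: "\<And>w l \<mu>. (w, l) \<in> E \<Longrightarrow> l \<le> \<mu> \<Longrightarrow> (w, \<mu>) \<in> E"
  shows "\<exists>g. ereal_epigraph g = E"
proof
  define g where "g w = (INF l\<in>{l. (w, l) \<in> E}. ereal l)" for w
  show "ereal_epigraph g = E"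
  proof (intro equalityI subsetI; clarsimp simp: ereal_epigraph_def)
    fix w l assume le: "g w \<le> ereal l"
    have mem: "(w, l + inverse (real (Suc n))) \<in> E" for n
    proof -
      have "g w < ereal (l + inverse (real (Suc n)))" using le by (rule le_less_trans) simp
      then obtain \<mu> where "(w, \<mu>) \<in> E" "\<mu> < l + inverse (real (Suc n))"
        unfolding g_def INF_less_iff by auto
      then show ?thesis using up by (meson less_imp_le)
    qed
    have lim: "(\<lambda>n. (w, l + inverse (real (Suc n)))) \<longlonglongrightarrow> (w, l)"
      using tendsto_add[OF tendsto_const[of l] LIMSEQ_inverse_real_of_nat]
      by (intro tendsto_Pair tendsto_const) simp
    show "(w, l) \<in> E" using closed_sequentially[OF clo mem lim] .
  next
    fix w l assume "(w, l) \<in> E"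
    then show "g w \<le> ereal l" unfolding g_def by (intro INF_lower) simp
  qed
qed

text \<open>This discharges the definite description in \<open>M_limit\<close>. Upward closure of
  the lower limit comes from shifting a recovery sequence vertically.\<close>

lemma ereal_epigraph_M_limit:
  "ereal_epigraph (M_limit F) = set_liminf (\<lambda>\<tau>. ereal_epigraph (F \<tau>))"
proof -
  let ?E = "set_liminf (\<lambda>\<tau>. ereal_epigraph (F \<tau>))"
  have "(w, \<mu>) \<in> ?E" if mem: "(w, l) \<in> ?E" and le: "l \<le> \<mu>" for w l \<mu>
    unfolding set_liminf_def
  proof (intro CollectI allI impI)
    fix t :: "nat \<Rightarrow> real" assume "(\<forall>n. t n > 0) \<and> t \<longlonglongrightarrow> 0"
    then obtain X N where X: "X \<longlonglongrightarrow> (w, l)" "\<And>n. n \<ge> N \<Longrightarrow> X n \<in> ereal_epigraph (F (t n))"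
      using mem unfolding set_liminf_def by blast
    have "(\<lambda>n. X n + (0, \<mu> - l)) \<longlonglongrightarrow> (w, l) + (0, \<mu> - l)" by (intro tendsto_intros X)
    moreover have "X n + (0, \<mu> - l) \<in> ereal_epigraph (F (t n))" if "n \<ge> N" for n
      using X(2)[OF that] le by (cases "X n") (auto simp: ereal_epigraph_def intro: order_trans)
    ultimately show "\<exists>Y N. Y \<longlonglongrightarrow> (w, \<mu>) \<and> (\<forall>n\<ge>N. Y n \<in> ereal_epigraph (F (t n)))"
      by (intro exI[of _ "\<lambda>n. X n + (0, \<mu> - l)"] exI[of _ N]) simp
  qed
  then obtain g where g: "ereal_epigraph g = ?E"
    using closed_upward_imp_ereal_epigraph[OF closed_set_liminf] by blast
  then have "M_limit F = g" unfolding M_limit_def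
    by (intro the_equality) (auto intro: ereal_epigraph_inject)
  with g show ?thesis by simp
qed

lemma closed_ereal_epigraph_iff:
  fixes f :: "'a::metric_space \<Rightarrow> ereal"
  shows "closed (ereal_epigraph f) \<longleftrightarrow> ereal_lsc f"
proof
  assume clo: "closed (ereal_epigraph f)"
  show "ereal_lsc f" unfolding ereal_lsc_def le_Liminf_iff
  proof (intro allI impI)
    fix x y assume "y < f x"
    then obtain r where r: "y < ereal r" "ereal r < f x" using ereal_dense2 by blast
    have "((\<lambda>z. (z, r)) \<longlongrightarrow> (x, r)) (at x)" by (intro tendsto_intros)
    moreover have "open (- ereal_epigraph f)" "(x, r) \<in> - ereal_epigraph f"
      using clo r(2) by (auto simp: ereal_epigraph_def)
    ultimately have "\<forall>\<^sub>F z in at x. (z, r) \<in> - ereal_epigraph f" by (rule topological_tendstoD)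
    then show "\<forall>\<^sub>F z in at x. y < f z"
      by eventually_elim (use r(1) in \<open>auto simp: ereal_epigraph_def not_le intro: less_trans\<close>)
  qed
next
  assume lsc: "ereal_lsc f"
  show "closed (ereal_epigraph f)" unfolding closed_sequential_limits
  proof (intro allI impI, elim conjE)
    fix X p assume X: "\<forall>n. X n \<in> ereal_epigraph f" and lim: "X \<longlonglongrightarrow> p"
    obtain x r where p: "p = (x, r)" by (cases p)
    have fst: "(\<lambda>n. fst (X n)) \<longlonglongrightarrow> x" and snd: "(\<lambda>n. snd (X n)) \<longlonglongrightarrow> r"
      using tendsto_fst[OF lim] tendsto_snd[OF lim] by (simp_all add: p)
    have "f x \<le> ereal r"
    proof (rule ccontr)
      assume "\<not> ?thesis"
      then obtain c where c: "ereal r < ereal c" "ereal c < f x" using ereal_dense2 by (metis not_le)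
      have "\<forall>\<^sub>F z in at x. ereal c < f z"
        using lsc c(2) unfolding ereal_lsc_def le_Liminf_iff by blast
      \<comment> \<open>The filter \<open>at x\<close> leaves out \<open>x\<close> itself; adding it
        back covers sequences that hit \<open>x\<close>.\<close>
      then have "\<forall>\<^sub>F z in nhds x. ereal c < f z" using c(2) by (simp add: eventually_nhds_conv_at)
      then have "\<forall>\<^sub>F n in sequentially. ereal c < f (fst (X n))"
        using fst by (rule eventually_compose_filterlim)
      moreover have "\<forall>\<^sub>F n in sequentially. snd (X n) < c" using snd c(1) by (simp add: order_tendstoD)
      ultimately have "\<forall>\<^sub>F n in sequentially. False"
      proof eventually_elim
        case (elim n)
        have "f (fst (X n)) \<le> ereal (snd (X n))" using X by (auto simp: ereal_epigraph_def case_prod_beta)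
        also have "\<dots> < ereal c" using elim by simp
        finally show ?case using elim by simp
      qed
      then show False by simp
    qed
    then show "p \<in> ereal_epigraph f" by (simp add: p ereal_epigraph_def)
  qed
qed

lemma convex_ereal_epigraph_iff:
  assumes "\<And>x. f x \<noteq> - \<infinity>"
  shows "convex (ereal_epigraph f) \<longleftrightarrow> ereal_convex f"
proof
  assume conv: "convex (ereal_epigraph f)"
  show "ereal_convex f" unfolding ereal_convex_def
  proof (intro allI ballI)
    fix x y and s :: real assume s: "s \<in> {0<..<1}"
    show "f ((1 - s) *\<^sub>R x + s *\<^sub>R y) \<le> ereal (1 - s) * f x + ereal s * f y"
    proof (cases "f x = \<infinity> \<or> f y = \<infinity>")
      \<comment> \<open>As -\<infinity> is excluded, the right-hand side is unambiguously
        \<infinity>.\<close>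
      case True
      then show ?thesis using s assms[of x] assms[of y]
        by (cases "f x"; cases "f y") auto
    next
      case False
      then obtain a b where ab: "f x = ereal a" "f y = ereal b"
        using assms by (metis ereal_cases)
      then have "(x, a) \<in> ereal_epigraph f" "(y, b) \<in> ereal_epigraph f"
        by (auto simp: ereal_epigraph_def)
      from convexD[OF conv this, of "1 - s" s] show ?thesis
        using s ab by (simp add: ereal_epigraph_def)
    qed
  qed
next
  assume f: "ereal_convex f"
  show "convex (ereal_epigraph f)" unfolding convex_alt
  proof (intro ballI allI impI, clarify)
    fix x y and a b s :: real
    assume mem: "(x, a) \<in> ereal_epigraph f" "(y, b) \<in> ereal_epigraph f" and s: "0 \<le> s" "s \<le> 1"
    consider "s = 0" | "s = 1" | "s \<in> {0<..<1}" using s by fastforce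
    then show "(1 - s) *\<^sub>R (x, a) + s *\<^sub>R (y, b) \<in> ereal_epigraph f"
    proof cases
      case 3
      then have "f ((1 - s) *\<^sub>R x + s *\<^sub>R y) \<le> ereal (1 - s) * f x + ereal s * f y"
        using f unfolding ereal_convex_def by blast
      also have "\<dots> \<le> ereal (1 - s) * ereal a + ereal s * ereal b"
        using mem s by (intro add_mono ereal_mult_left_mono) (auto simp: ereal_epigraph_def)
      finally show ?thesis by (simp add: ereal_epigraph_def)
    qed (use mem in \<open>auto simp: zero_prod_def[symmetric]\<close>)
  qed
qed

text \<open>In this form membership can be checked through set operations that preserve closedness
  and convexity: lower limits for \<open>M_limit\<close>, affine preimages for the difference
  quotients.\<close>

lemma Gamma0_iff_epigraph:
  "f \<in> Gamma0 \<longleftrightarrow>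
     ereal_proper f \<and> closed (ereal_epigraph f) \<and> convex (ereal_epigraph f)"
proof (cases "ereal_proper f")
  case True
  then have "convex (ereal_epigraph f) \<longleftrightarrow> ereal_convex f"
    by (intro convex_ereal_epigraph_iff) (simp add: ereal_proper_def)
  then show ?thesis by (simp add: Gamma0_def closed_ereal_epigraph_iff)
qed (simp add: Gamma0_def)

section \<open>Convergence of the proximal points\<close>

lemma variational_pair_tendsto:
  fixes S :: "real \<Rightarrow> ('a::{real_inner,complete_space} \<times> real) set"
  assumes Mosco: "set_M_convergent S"
    and conv: "\<And>\<tau>. \<tau> > 0 \<Longrightarrow> convex (S \<tau>)" and zero: "\<And>\<tau>. \<tau> > 0 \<Longrightarrow> (0, 0) \<in> S \<tau>"
    and K: "K > 0" and out: "(0, - K) \<notin> set_liminf S"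
    and pair: "\<And>\<tau>. \<tau> > 0 \<Longrightarrow> variational_pair (S \<tau>) (z \<tau>) (a \<tau>)"
    and limpair: "variational_pair (set_liminf S) z0 a0"
  shows "((\<lambda>\<tau>. (z \<tau>, a \<tau>)) \<longlongrightarrow> (z0, a0)) (at_right 0)"
proof -
  have wlimsup: "p \<in> set_liminf S"
    if "\<And>n. t n > 0" "t \<longlonglongrightarrow> 0" "weakly_tendsto X p" "\<And>n. X n \<in> S (t n)" for t X p
    using Mosco that unfolding set_M_convergent_def set_wlimsup_def by blast
  \<comment> \<open>Otherwise there are points \<open>(w n, - K)\<close> of \<open>S (t n)\<close>
    converging strongly, hence weakly, to \<open>(0, - K)\<close>, and Mosco convergence would put
    that point into the lower limit.\<close>
  have "\<exists>\<delta>>0. \<forall>\<tau> w. 0 < \<tau> \<longrightarrow> \<tau> < \<delta> \<longrightarrow> norm w < \<delta> \<longrightarrow> (w, - K) \<notin> S \<tau>"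
  proof (rule ccontr)
    assume "\<not> ?thesis"
    then have "\<exists>\<tau> w. 0 < \<tau> \<and> \<tau> < inverse (real (Suc n)) \<and> norm w < inverse (real (Suc n)) \<and>
        (w, - K) \<in> S \<tau>" for n
      by (metis inverse_positive_iff_positive of_nat_0_less_iff zero_less_Suc)
    then obtain t w where tw: "\<And>n. 0 < t n" "\<And>n. t n < inverse (real (Suc n))"
      "\<And>n. norm (w n) < inverse (real (Suc n))" "\<And>n. (w n, - K) \<in> S (t n)" by metis
    have t0: "t \<longlonglongrightarrow> 0"
      by (rule Lim_null_comparison[OF _ LIMSEQ_inverse_real_of_nat])
        (use tw in \<open>auto simp: less_imp_le simp del: of_nat_Suc\<close>)
    have "w \<longlonglongrightarrow> 0"
      by (rule Lim_null_comparison[OF _ LIMSEQ_inverse_real_of_nat])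
        (use tw in \<open>auto simp: less_imp_le simp del: of_nat_Suc\<close>)
    then have "(\<lambda>n. (w n, - K)) \<longlonglongrightarrow> (0, - K)" by (intro tendsto_intros)
    then have "weakly_tendsto (\<lambda>n. (w n, - K)) (0, - K)"
      unfolding weakly_tendsto_def by (intro allI tendsto_inner tendsto_const)
    with wlimsup[OF tw(1) t0] tw(4) out show False by blast
  qed
  then obtain \<delta> where \<delta>: "\<delta> > 0"
    and avoid: "\<And>\<tau> w. 0 < \<tau> \<Longrightarrow> \<tau> < \<delta> \<Longrightarrow> norm w < \<delta> \<Longrightarrow> (w, - K) \<notin> S \<tau>" by blast
  define c where "c = K / \<delta>"
  \<comment> \<open>Testing the inequality at \<open>(0, 0)\<close> and using the uniform minorant
    gives \<open>norm (z \<tau>)^2 \<le> K + c * norm (z \<tau>)\<close>. This fails as soon as the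
    norm exceeds both 1 and \<open>K + c\<close>.\<close>
  define R where "R = 1 + K + c"
  have c: "c > 0" using K \<delta> by (simp add: c_def)
  have bound: "norm (z \<tau>) \<le> R \<and> \<bar>a \<tau>\<bar> \<le> K + c * R" if \<tau>: "0 < \<tau>" "\<tau> < \<delta>" for \<tau>
  proof -
    have mem: "(z \<tau>, a \<tau>) \<in> S \<tau>" using pair[OF \<tau>(1)] by (simp add: variational_pair_def)
    have up: "a \<tau> + (norm (z \<tau>))\<^sup>2 \<le> 0"
      using pair[OF \<tau>(1)] zero[OF \<tau>(1)]
      by (force simp: variational_pair_def power2_norm_eq_inner)
    have lo: "- K - c * norm (z \<tau>) \<le> a \<tau>"
      unfolding c_def using convex_epi_minorant[OF conv zero K \<delta> avoid mem] \<tau> by blast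
    have "norm (z \<tau>) \<le> R"
    proof (rule ccontr)
      assume "\<not> ?thesis"
      then have R: "R < norm (z \<tau>)" by simp
      then have "1 < norm (z \<tau>)" using K c by (simp add: R_def)
      then have "(K + c) * norm (z \<tau>) \<ge> K + c * norm (z \<tau>)"
        using K by (simp add: distrib_right)
      moreover have "norm (z \<tau>) * norm (z \<tau>) > (K + c) * norm (z \<tau>)"
        using R \<open>1 < norm (z \<tau>)\<close> by (intro mult_strict_right_mono) (auto simp: R_def)
      ultimately show False using up lo by (simp add: power2_eq_square)
    qed
    moreover from this have "c * norm (z \<tau>) \<le> c * R" using c by simp
    moreover have "a \<tau> \<le> 0" using up zero_le_power2[of "norm (z \<tau>)"] by linarith
    ultimately show ?thesis using lo K by auto
  qed
  have *: "\<exists>n. dist (z (t n), a (t n)) (z0, a0) < e"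
    if e: "e > 0" and t: "\<And>n. t n > 0" "\<And>n. t n < \<delta>" "t \<longlonglongrightarrow> 0" for e t
  proof -
    obtain r1 \<zeta> where r1: "strict_mono r1" and weak1: "weakly_tendsto ((\<lambda>n. z (t n)) \<circ> r1) \<zeta>"
      using bounded_weakly_convergent_subsequence[of "\<lambda>n. z (t n)" R] bound t by blast
    \<comment> \<open>A second extraction makes the heights and the squared norms converge. The
      limit \<open>N\<close> of the latter is kept apart from the squared norm of
      \<open>\<zeta>\<close>, since weak convergence does not identify the two.\<close>
    define h where "h n = (a (t (r1 n)), (norm (z (t (r1 n))))\<^sup>2)" for n
    have "h n \<in> {- (K + c * R)..K + c * R} \<times> {0..R\<^sup>2}" for n
      using bound[of "t (r1 n)"] t by (auto simp: h_def abs_le_iff intro!: power_mono)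
    moreover have "compact ({- (K + c * R)..K + c * R} \<times> {0..R\<^sup>2})" by (intro compact_Times compact_Icc)
    ultimately obtain q r2 where r2: "strict_mono r2" and hq: "(h \<circ> r2) \<longlonglongrightarrow> q"
      unfolding compact_def by meson
    obtain \<alpha> N where q: "q = (\<alpha>, N)" by (cases q)
    define u where "u = (\<lambda>n. t (r1 (r2 n)))"
    have u: "\<And>n. u n > 0" "\<And>n. u n < \<delta>" using t by (simp_all add: u_def)
    have r12: "strict_mono (r1 \<circ> r2)" using r1 r2 by (rule strict_mono_o)
    have u0: "u \<longlonglongrightarrow> 0" using LIMSEQ_subseq_LIMSEQ[OF t(3) r12] by (simp add: u_def o_def)
    have weak: "(\<lambda>n. inner (z (u n)) y) \<longlonglongrightarrow> inner \<zeta> y" for y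
      using weak1 LIMSEQ_subseq_LIMSEQ[OF _ r2, of "\<lambda>n. inner (z (t (r1 n))) y"]
      by (simp add: weakly_tendsto_def u_def o_def)
    have au: "(\<lambda>n. a (u n)) \<longlonglongrightarrow> \<alpha>"
      using tendsto_fst[OF hq] by (simp add: q h_def u_def o_def)
    have Nu: "(\<lambda>n. (norm (z (u n)))\<^sup>2) \<longlonglongrightarrow> N"
      using tendsto_snd[OF hq] by (simp add: q h_def u_def o_def)
    have "weakly_tendsto (\<lambda>n. (z (u n), a (u n))) (\<zeta>, \<alpha>)"
      unfolding weakly_tendsto_def by (auto intro!: tendsto_intros weak au)
    then have "(\<zeta>, \<alpha>) \<in> set_liminf S"
      using pair u by (intro wlimsup[OF u(1) u0]) (auto simp: variational_pair_def)
    then have le1: "a0 - inner z0 (\<zeta> - z0) \<le> \<alpha>"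
      using limpair by (auto simp: variational_pair_def)
    have "(z0, a0) \<in> set_liminf S" using limpair by (simp add: variational_pair_def)
    then obtain X M where X: "X \<longlonglongrightarrow> (z0, a0)" "\<And>n. n \<ge> M \<Longrightarrow> X n \<in> S (u n)"
      unfolding set_liminf_def using u(1) u0 by blast
    have X1: "(\<lambda>n. fst (X n)) \<longlonglongrightarrow> z0" and X2: "(\<lambda>n. snd (X n)) \<longlonglongrightarrow> a0"
      using tendsto_fst[OF X(1)] tendsto_snd[OF X(1)] by simp_all
    \<comment> \<open>A bounded weakly convergent sequence is paired with a strongly convergent
      one.\<close>
    have zX: "(\<lambda>n. inner (z (u n)) (fst (X n))) \<longlonglongrightarrow> inner \<zeta> z0"
    proof -
      have "(\<lambda>n. inner (z (u n)) (fst (X n) - z0)) \<longlonglongrightarrow> 0"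
      proof (rule Lim_null_comparison)
        show "\<forall>\<^sub>F n in sequentially. norm (inner (z (u n)) (fst (X n) - z0)) \<le> R * norm (fst (X n) - z0)"
        proof (rule always_eventually, rule allI)
          fix n
          have "norm (inner (z (u n)) (fst (X n) - z0)) \<le> norm (z (u n)) * norm (fst (X n) - z0)"
            using Cauchy_Schwarz_ineq2 by simp
          also have "\<dots> \<le> R * norm (fst (X n) - z0)"
            using bound[OF u] by (intro mult_right_mono) auto
          finally show "norm (inner (z (u n)) (fst (X n) - z0)) \<le> R * norm (fst (X n) - z0)" .
        qed
        have "(\<lambda>n. R * norm (fst (X n) - z0)) \<longlonglongrightarrow> R * norm (z0 - z0)" by (intro tendsto_intros X1)
        then show "(\<lambda>n. R * norm (fst (X n) - z0)) \<longlonglongrightarrow> 0" by simp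
      qed
      from tendsto_add[OF weak[of z0] this] show ?thesis by (simp add: inner_diff_right)
    qed
    \<comment> \<open>Here the inequality for \<open>z (u n)\<close> is tested at the recovery
      sequence \<open>X n\<close> of \<open>(z0, a0)\<close>; \<open>le1\<close> tested the limit
      inequality at the weak cluster point.\<close>
    have "\<alpha> - inner \<zeta> z0 + N \<le> a0"
    proof (rule LIMSEQ_le)
      show "(\<lambda>n. a (u n) - inner (z (u n)) (fst (X n)) + (norm (z (u n)))\<^sup>2) \<longlonglongrightarrow> \<alpha> - inner \<zeta> z0 + N"
        by (intro tendsto_intros au zX Nu)
      show "\<exists>m. \<forall>n\<ge>m. a (u n) - inner (z (u n)) (fst (X n)) + (norm (z (u n)))\<^sup>2 \<le> snd (X n)"
      proof (intro exI allI impI)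
        fix n assume "n \<ge> M"
        from X(2)[OF this] pair[OF u(1)[of n]]
        have "a (u n) - inner (z (u n)) (fst (X n) - z (u n)) \<le> snd (X n)"
          by (auto simp: variational_pair_def case_prod_beta)
        then show "a (u n) - inner (z (u n)) (fst (X n)) + (norm (z (u n)))\<^sup>2 \<le> snd (X n)"
          by (simp add: inner_diff_right power2_norm_eq_inner)
      qed
    qed (rule X2)
    \<comment> \<open>Adding the two inequalities cancels \<open>\<alpha>\<close> and
      \<open>a0\<close>. The remaining left-hand side is the limit of
      \<open>norm (z (u n) - z0)^2\<close>, so strong convergence follows.\<close>
    with le1 have le2: "N - 2 * inner \<zeta> z0 + (norm z0)\<^sup>2 \<le> 0"
      by (simp add: inner_diff_right power2_norm_eq_inner inner_commute)
    have "(\<lambda>n. (norm (z (u n)))\<^sup>2 - 2 * inner (z (u n)) z0 + (norm z0)\<^sup>2) \<longlonglongrightarrow>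
        N - 2 * inner \<zeta> z0 + (norm z0)\<^sup>2" by (intro tendsto_intros Nu weak)
    then have sq: "(\<lambda>n. (norm (z (u n) - z0))\<^sup>2) \<longlonglongrightarrow> N - 2 * inner \<zeta> z0 + (norm z0)\<^sup>2"
      by (simp add: power2_norm_eq_inner inner_diff_left inner_diff_right inner_commute algebra_simps)
    have "0 \<le> N - 2 * inner \<zeta> z0 + (norm z0)\<^sup>2"
      by (rule LIMSEQ_le_const[OF sq]) auto
    with le2 sq have "(\<lambda>n. (norm (z (u n) - z0))\<^sup>2) \<longlonglongrightarrow> 0" by simp
    from tendsto_real_sqrt[OF this] have "(\<lambda>n. norm (z (u n) - z0)) \<longlonglongrightarrow> 0" by simp
    then have zu: "(\<lambda>n. z (u n)) \<longlonglongrightarrow> z0" by (simp add: tendsto_norm_zero_iff LIM_zero_iff)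
    have eq: "inner \<zeta> z0 = inner z0 z0"
      by (rule LIMSEQ_unique[OF weak[of z0]]) (intro tendsto_intros zu)
    have "N = inner z0 z0"
      using le2 \<open>0 \<le> N - 2 * inner \<zeta> z0 + (norm z0)\<^sup>2\<close> eq by (simp add: power2_norm_eq_inner)
    with le1 \<open>\<alpha> - inner \<zeta> z0 + N \<le> a0\<close> eq have "\<alpha> = a0"
      by (simp add: inner_diff_right inner_commute)
    with au zu have "(\<lambda>n. (z (u n), a (u n))) \<longlonglongrightarrow> (z0, a0)" by (simp add: tendsto_Pair)
    from metric_LIMSEQ_D[OF this e] show ?thesis unfolding u_def by blast
  qed
  show ?thesis
  proof (rule tendstoI, rule eventually_at_right_0_sequentially)
    fix e :: real and t :: "nat \<Rightarrow> real"
    assume e: "e > 0" and t: "\<And>n. t n > 0" "t \<longlonglongrightarrow> 0"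
    obtain M where M: "\<And>n. n \<ge> M \<Longrightarrow> t n < \<delta>"
      using order_tendstoD(2)[OF t(2) \<delta>] by (auto simp: eventually_sequentially)
    \<comment> \<open>The shift by \<open>M\<close> keeps the whole sequence below
      \<open>\<delta>\<close>, where the uniform bounds hold.\<close>
    have "\<exists>n. dist (z (t (n + M)), a (t (n + M))) (z0, a0) < e"
      using e t M by (intro *[of e "\<lambda>n. t (n + M)"]) (auto intro: LIMSEQ_ignore_initial_segment)
    then show "\<exists>n. dist (z (t n), a (t n)) (z0, a0) < e" by blast
  qed
qed

section \<open>Supporting hyperplanes and limits of normalised families\<close>

text \<open>The inequality in \<open>variational_pair\<close> is a subgradient inequality with slope
  \<open>- z\<close>; expanding \<open>a - inner z (w - z)\<close> gives the constant term.
  Evaluating it at \<open>z\<close> forces \<open>F z = a\<close>.\<close>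

lemma supporting_hyperplane_variational_pair:
  assumes "variational_pair (ereal_epigraph F) z a" and "\<And>w. F w \<noteq> - \<infinity>"
  shows "supporting_hyperplane F (z, - z, a + inner z z)"
proof -
  have le: "ereal (inner (- z) w + (a + inner z z)) \<le> F w" for w
  proof (cases "F w")
    case (real \<mu>)
    then have "(w, \<mu>) \<in> ereal_epigraph F" by (simp add: ereal_epigraph_def)
    with assms(1) real show ?thesis by (auto simp: variational_pair_def inner_diff_right)
  qed (use assms(2) in auto)
  have "F z \<le> ereal a" using assms(1) by (simp add: variational_pair_def ereal_epigraph_def)
  with le[of z] have "F z = ereal (inner (- z) z + (a + inner z z))" by simp
  with le show ?thesis by (simp add: supporting_hyperplane_def)
qed

text \<open>Along one null sequence the slopes, the constants and the recovery points all converge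
  strongly, so the affine minorants pass to the limit.\<close>

lemma set_liminf_supporting_minorant:
  assumes supp: "\<And>\<tau>. \<tau> > 0 \<Longrightarrow> supporting_hyperplane (F \<tau>) (p \<tau>)"
    and lim: "(p \<longlongrightarrow> (z, \<xi>, \<beta>)) (at_right 0)"
    and mem: "(w, \<mu>) \<in> set_liminf (\<lambda>\<tau>. ereal_epigraph (F \<tau>))"
  shows "inner \<xi> w + \<beta> \<le> \<mu>"
proof -
  define t where "t n = inverse (real (Suc n))" for n
  have t: "\<And>n. t n > 0" "t \<longlonglongrightarrow> 0"
    using LIMSEQ_inverse_real_of_nat by (simp_all add: t_def[abs_def])
  obtain X N where X: "X \<longlonglongrightarrow> (w, \<mu>)" "\<And>n. n \<ge> N \<Longrightarrow> X n \<in> ereal_epigraph (F (t n))"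
    using mem t unfolding set_liminf_def by blast
  have pt: "(\<lambda>n. p (t n)) \<longlonglongrightarrow> (z, \<xi>, \<beta>)"
    using lim filterlim_at_right_0_sequence[OF t] by (rule filterlim_compose)
  have X12: "(\<lambda>n. fst (X n)) \<longlonglongrightarrow> w" "(\<lambda>n. snd (X n)) \<longlonglongrightarrow> \<mu>"
    using tendsto_fst[OF X(1)] tendsto_snd[OF X(1)] by simp_all
  have p12: "(\<lambda>n. fst (snd (p (t n)))) \<longlonglongrightarrow> \<xi>" "(\<lambda>n. snd (snd (p (t n)))) \<longlonglongrightarrow> \<beta>"
    using tendsto_fst[OF tendsto_snd[OF pt]] tendsto_snd[OF tendsto_snd[OF pt]] by simp_all
  show ?thesis
  proof (rule LIMSEQ_le)
    show "(\<lambda>n. inner (fst (snd (p (t n)))) (fst (X n)) + snd (snd (p (t n)))) \<longlonglongrightarrow> inner \<xi> w + \<beta>"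
      by (intro tendsto_intros p12 X12)
    show "\<exists>M. \<forall>n\<ge>M. inner (fst (snd (p (t n)))) (fst (X n)) + snd (snd (p (t n))) \<le> snd (X n)"
    proof (intro exI allI impI)
      fix n assume "n \<ge> N"
      from X(2)[OF this] have "F (t n) (fst (X n)) \<le> ereal (snd (X n))"
        by (simp add: ereal_epigraph_def case_prod_beta)
      moreover have "ereal (inner (fst (snd (p (t n)))) (fst (X n)) + snd (snd (p (t n)))) \<le> F (t n) (fst (X n))"
        using supp[OF t(1)[of n]] unfolding supporting_hyperplane_def by (auto simp: case_prod_beta)
      ultimately have "ereal (inner (fst (snd (p (t n)))) (fst (X n)) + snd (snd (p (t n)))) \<le> ereal (snd (X n))"
        by (rule order_trans[rotated])
      then show "inner (fst (snd (p (t n)))) (fst (X n)) + snd (snd (p (t n))) \<le> snd (X n)" by simp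
    qed
  qed (rule X12)
qed

text \<open>For a normalised family, i.e. one with \<open>F \<tau> 0 = 0\<close>, the limit is at most \<open>0\<close> at the
  origin, so its only possible defect is the value \<open>-\<infinity>\<close>.\<close>

lemma M_limit_Gamma0_iff:
  fixes F :: "real \<Rightarrow> 'a::{real_inner,complete_space} \<Rightarrow> ereal"
  assumes F: "\<And>\<tau>. \<tau> > 0 \<Longrightarrow> F \<tau> \<in> Gamma0" and F0: "\<And>\<tau>. \<tau> > 0 \<Longrightarrow> F \<tau> 0 = 0"
    and M: "M_convergent F"
  shows "M_limit F \<in> Gamma0 \<longleftrightarrow> admits_convergent_supporting_hyperplane F"
proof -
  define S where "S = (\<lambda>\<tau>. ereal_epigraph (F \<tau>))"
  have epi: "ereal_epigraph (M_limit F) = set_liminf S" by (simp add: S_def ereal_epigraph_M_limit)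
  have clo: "closed (S \<tau>)" and conv: "convex (S \<tau>)" and fin: "\<And>w. F \<tau> w \<noteq> - \<infinity>"
    and zero: "(0, 0) \<in> S \<tau>" if "\<tau> > 0" for \<tau>
    using F[OF that] F0[OF that]
    by (auto simp: Gamma0_iff_epigraph S_def ereal_epigraph_def ereal_proper_def)
  have convE: "convex (set_liminf S)" using conv by (rule convex_set_liminf)
  have zeroE: "(0, 0) \<in> set_liminf S"
    unfolding set_liminf_def using zero by (auto intro!: exI[of _ "\<lambda>_. (0, 0)"])
  show ?thesis
  proof
    assume G: "M_limit F \<in> Gamma0"
    have "M_limit F 0 \<noteq> - \<infinity>" using G by (simp add: Gamma0_def ereal_proper_def)
    \<comment> \<open>The level \<open>- K\<close> lies strictly below the limit function at the
      origin; this is the excluded point that gives both the minimiser of the limit and the uniform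
      bounds.\<close>
    then obtain K where K: "ereal (- K) < M_limit F 0" "K > 0"
    proof (cases "M_limit F 0")
      case (real r)
      then show ?thesis by (intro that[of "\<bar>r\<bar> + 1"]) auto
    qed (auto intro: that[of 1])
    then have out: "(0, - K) \<notin> set_liminf S"
      unfolding epi[symmetric] by (simp add: ereal_epigraph_def)
    obtain z0 a0 where lim: "variational_pair (set_liminf S) z0 a0"
      using variational_pair_exists[OF closed_set_liminf convE zeroE K(2) out] .
    have "\<exists>z a. variational_pair (S \<tau>) z a" if \<tau>: "\<tau> > 0" for \<tau>
    proof -
      have "(0, - 1) \<notin> S \<tau>" using F0[OF \<tau>] by (simp add: S_def ereal_epigraph_def)
      then show ?thesis
        using variational_pair_exists[OF clo[OF \<tau>] conv[OF \<tau>] zero[OF \<tau>] zero_less_one] by blast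
    qed
    then obtain z a where za: "\<And>\<tau>. \<tau> > 0 \<Longrightarrow> variational_pair (S \<tau>) (z \<tau>) (a \<tau>)" by metis
    have Mosco: "set_M_convergent S" using M by (simp add: M_convergent_def S_def)
    have za0: "((\<lambda>\<tau>. (z \<tau>, a \<tau>)) \<longlongrightarrow> (z0, a0)) (at_right 0)"
      using variational_pair_tendsto[OF Mosco conv zero K(2) out za lim] by simp
    have z_lim: "(z \<longlongrightarrow> z0) (at_right 0)" and a_lim: "(a \<longlongrightarrow> a0) (at_right 0)"
      using tendsto_fst[OF za0] tendsto_snd[OF za0] by simp_all
    have "((\<lambda>\<tau>. (z \<tau>, - z \<tau>, a \<tau> + inner (z \<tau>) (z \<tau>))) \<longlongrightarrow> (z0, - z0, a0 + inner z0 z0)) (at_right 0)"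
      by (intro tendsto_intros z_lim a_lim)
    moreover have "supporting_hyperplane (F \<tau>) (z \<tau>, - z \<tau>, a \<tau> + inner (z \<tau>) (z \<tau>))" if "\<tau> > 0" for \<tau>
      using za[OF that] fin[OF that] unfolding S_def by (rule supporting_hyperplane_variational_pair)
    ultimately show "admits_convergent_supporting_hyperplane F"
      unfolding admits_convergent_supporting_hyperplane_def
      by (intro exI[of _ "\<lambda>\<tau>. (z \<tau>, - z \<tau>, a \<tau> + inner (z \<tau>) (z \<tau>))"]) blast
  next
    assume "admits_convergent_supporting_hyperplane F"
    then obtain p z \<xi> \<beta> where supp: "\<And>\<tau>. \<tau> > 0 \<Longrightarrow> supporting_hyperplane (F \<tau>) (p \<tau>)"
      and p: "(p \<longlongrightarrow> (z, \<xi>, \<beta>)) (at_right 0)"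
      unfolding admits_convergent_supporting_hyperplane_def by (metis prod_cases3)
    have "M_limit F w \<noteq> - \<infinity>" for w
    proof
      assume "M_limit F w = - \<infinity>"
      \<comment> \<open>At a point with value -\<infinity> the epigraph contains the whole vertical
        line, in particular the point one unit below the limiting affine minorant.\<close>
      then have "(w, inner \<xi> w + \<beta> - 1) \<in> set_liminf (\<lambda>\<tau>. ereal_epigraph (F \<tau>))"
        using epi by (auto simp: S_def ereal_epigraph_def)
      from set_liminf_supporting_minorant[OF supp p this] show False by simp
    qed
    moreover have "M_limit F 0 \<noteq> \<infinity>"
      using zeroE unfolding epi[symmetric] by (auto simp: ereal_epigraph_def)
    ultimately have "ereal_proper (M_limit F)" by (auto simp: ereal_proper_def)
    then show "M_limit F \<in> Gamma0"
      by (simp add: Gamma0_iff_epigraph epi closed_set_liminf convE)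
  qed
qed

section \<open>Second-order difference quotients\<close>

lemma second_diff_quot_le_iff:
  assumes c: "f \<tau> x = ereal c" and \<tau>: "\<tau> > 0"
  shows "second_diff_quot f x v \<tau> w \<le> ereal \<mu> \<longleftrightarrow>
    f \<tau> (x + \<tau> *\<^sub>R w) \<le> ereal (\<tau>\<^sup>2 * \<mu> + c + \<tau> * inner v w)"
proof (cases "f \<tau> (x + \<tau> *\<^sub>R w)")
  case (real r)
  have "second_diff_quot f x v \<tau> w = ereal ((r - c - \<tau> * inner v w) / \<tau>\<^sup>2)"
    using \<tau> by (simp add: second_diff_quot_def real c)
  then show ?thesis using \<tau> real by (auto simp: pos_divide_le_eq mult.commute)
qed (use c \<tau> in \<open>simp_all add: second_diff_quot_def\<close>)

text \<open>Clearing denominators exhibits the epigraph of the quotient as an affine preimage of the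
  epigraph of \<open>f \<tau>\<close>, so closedness and convexity are inherited.\<close>

lemma second_diff_quot_Gamma0:
  assumes f: "f \<tau> \<in> Gamma0" and c: "f \<tau> x = ereal c" and \<tau>: "\<tau> > 0"
  shows "second_diff_quot f x v \<tau> \<in> Gamma0"
proof -
  \<comment> \<open>\<open>L\<close> carries the scaling and the term in \<open>v\<close>; the base
    point \<open>(x, c)\<close> is moved into a translation so that \<open>L\<close> is
    linear.\<close>
  define L where "L = (\<lambda>(w, \<mu>). (\<tau> *\<^sub>R w, \<tau>\<^sup>2 * \<mu> + \<tau> * inner v w))"
  have lin: "linear L"
    by (intro linearI) (auto simp: L_def inner_add_right algebra_simps)
  have cont: "continuous_on UNIV L"
    unfolding L_def case_prod_beta by (intro continuous_intros)
  have epi: "ereal_epigraph (second_diff_quot f x v \<tau>) =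
      L -` ((\<lambda>y. y - (x, c)) ` ereal_epigraph (f \<tau>))"
  proof -
    have "p \<in> (\<lambda>y. y - (x, c)) ` ereal_epigraph (f \<tau>) \<longleftrightarrow> p + (x, c) \<in> ereal_epigraph (f \<tau>)" for p
      by (force simp: image_iff)
    then show ?thesis
      by (auto simp: ereal_epigraph_def second_diff_quot_le_iff[of f \<tau> x c, OF c \<tau>] L_def ac_simps)
  qed
  have "closed (ereal_epigraph (f \<tau>))" "convex (ereal_epigraph (f \<tau>))"
    and fin: "\<And>y. f \<tau> y \<noteq> - \<infinity>"
    using f by (auto simp: Gamma0_iff_epigraph ereal_proper_def)
  then have "closed ((\<lambda>y. y - (x, c)) ` ereal_epigraph (f \<tau>))"
    "convex ((\<lambda>y. y - (x, c)) ` ereal_epigraph (f \<tau>))"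
    by (auto intro: closed_translation_subtract convex_translation_subtract)
  then have "closed (ereal_epigraph (second_diff_quot f x v \<tau>))"
    "convex (ereal_epigraph (second_diff_quot f x v \<tau>))"
    unfolding epi using lin cont
    by (auto intro: convex_linear_vimage continuous_closed_vimage simp: continuous_on_eq_continuous_at)
  moreover have "ereal_proper (second_diff_quot f x v \<tau>)"
    unfolding ereal_proper_def
  proof (intro conjI allI exI)
    show "second_diff_quot f x v \<tau> w \<noteq> - \<infinity>" for w
      using fin[of "x + \<tau> *\<^sub>R w"] c \<tau>
      by (cases "f \<tau> (x + \<tau> *\<^sub>R w)") (auto simp: second_diff_quot_def)
    show "second_diff_quot f x v \<tau> 0 \<noteq> \<infinity>" using c \<tau> by (simp add: second_diff_quot_def)
  qed
  ultimately show ?thesis by (simp add: Gamma0_iff_epigraph)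
qed

theorem proposition39:
  fixes f :: "real \<Rightarrow> 'a::{real_inner, complete_space} \<Rightarrow> ereal"
    and x v :: 'a
  assumes "f \<in> Gamma0_param"
    and "x \<in> finite_points f"
    and "v \<in> subdifferential (f 0) x"
    and "twice_epi_differentiable f x v"
  shows "second_epi_derivative f x v \<in> Gamma0 \<longleftrightarrow>
    admits_convergent_supporting_hyperplane (second_diff_quot f x v)"
  unfolding second_epi_derivative_def
proof (rule M_limit_Gamma0_iff)
  fix \<tau> :: real assume \<tau>: "\<tau> > 0"
  have "f \<tau> x \<in> range ereal" using assms(2) \<tau> by (simp add: finite_points_def)
  then obtain c where c: "f \<tau> x = ereal c" by blast
  show "second_diff_quot f x v \<tau> \<in> Gamma0"
    using assms(1) \<tau> c by (intro second_diff_quot_Gamma0) (auto simp: Gamma0_param_def)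
  show "second_diff_quot f x v \<tau> 0 = 0" by (simp add: second_diff_quot_def c zero_ereal_def)
qed (use assms(4) in \<open>simp add: twice_epi_differentiable_def\<close>)

end
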